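(* Let $X$ be a separable metrizable space endowed with an admissible representation. The following are equivalent: (1) $\mathrm{Spec}^p(X)\subseteq\mathcal D_T$ for some oracle $p\in\{0,1\}^{\mathbb N}$. (2) $X$ is countable dimensional.
   Context: A representation of $X$ is a partial surjection $\delta_X:\subseteq\mathbb N^{\mathbb N}\to X$; it is admissible if it is continuous and every continuous $\varphi:\subseteq\mathbb N^{\mathbb N}\to X$ has the form $\varphi=\delta_X\circ G$ (on $\mathrm{dom}(\varphi)$) for some continuous partial $G$ on $\mathbb N^{\mathbb N}$. For $A,B\subseteq\mathbb N^{\mathbb N}$, $A$ is Medvedev reducible to $B$ if there is a partial computable $F$ on $\mathbb N^{\mathbb N}$ defined on all of $B$ with $F[B]\subseteq A$; $\equiv_M$ is the induced equivalence, whose classes are the Medvedev degrees. For an oracle $p$ and $x\in X$, $\deg^p(x)=[\{p\}\times\delta_X^{-1}(x)]_{\equiv_M}$ and $\mathrm{Spec}^p(X)=\{\deg^p(x):x\in X\}$. $\mathcal D_T$ denotes the Turing degrees viewed as the set of Medvedev degrees of singletons $\{q\}$, $q\in\mathbb N^{\mathbb N}$. A space is countable dimensional if it is a countable union of finite dimensional subspaces. *)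

theory Defs
  imports "HOL-Analysis.Analysis"
begin

text \<open>
  Baire space is the type \<^typ>\<open>nat \<Rightarrow> nat\<close> with its type-class topology, which is the product
  of the discrete topologies. Partial functions are maps into an option type.
\<close>

type_synonym baire = "nat \<Rightarrow> nat"

definition partial_continuous :: "'b topology \<Rightarrow> 'a topology \<Rightarrow> ('b \<rightharpoonup> 'a) \<Rightarrow> bool" where
  "partial_continuous Y X f \<longleftrightarrow> dom f \<subseteq> topspace Y
     \<and> continuous_map (subtopology Y (dom f)) X (the \<circ> f)"


section \<open>Representations\<close>

definition representation :: "'a topology \<Rightarrow> (baire \<rightharpoonup> 'a) \<Rightarrow> bool" where
  "representation X \<delta> \<longleftrightarrow> ran \<delta> = topspace X"

definition admissible_representation :: "'a topology \<Rightarrow> (baire \<rightharpoonup> 'a) \<Rightarrow> bool" where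
  "admissible_representation X \<delta> \<longleftrightarrow> representation X \<delta> \<and> partial_continuous euclidean X \<delta>
     \<and> (\<forall>\<phi> :: baire \<rightharpoonup> 'a. partial_continuous euclidean X \<phi> \<longrightarrow>
          (\<exists>G :: baire \<rightharpoonup> baire. partial_continuous euclidean euclidean G
             \<and> (\<forall>q \<in> dom \<phi>. \<phi> q = (\<delta> \<circ>\<^sub>m G) q)))"


section \<open>Partial computable functions on Baire space\<close>

text \<open>
  Programs for the functions that are partial recursive relative to an oracle: Kleene's schemes
  together with a query to the oracle. Recursion is on the first argument, and minimisation
  searches over the first argument.
\<close>

datatype prog =
    Zero
  | Succ
  | Proj nat
  | Query
  | Comp prog "prog list"
  | PrimRec prog prog
  | Mu prog

text \<open>\<open>runs q e xs y\<close>: with oracle \<open>q\<close>, program \<open>e\<close> halts on the arguments \<open>xs\<close> with value \<open>y\<close>.\<close>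

inductive runs :: "baire \<Rightarrow> prog \<Rightarrow> nat list \<Rightarrow> nat \<Rightarrow> bool" for q :: baire where
  zero: "runs q Zero xs 0"
| succ: "runs q Succ [x] (Suc x)"
| proj: "i < length xs \<Longrightarrow> runs q (Proj i) xs (xs ! i)"
| query: "runs q Query [x] (q x)"
| comp: "\<lbrakk>list_all2 (\<lambda>e y. runs q e xs y) es ys; runs q e ys z\<rbrakk> \<Longrightarrow> runs q (Comp e es) xs z"
| primrec_0: "runs q d xs z \<Longrightarrow> runs q (PrimRec d e) (0 # xs) z"
| primrec_Suc: "\<lbrakk>runs q (PrimRec d e) (n # xs) y; runs q e (n # y # xs) z\<rbrakk>
    \<Longrightarrow> runs q (PrimRec d e) (Suc n # xs) z"
| mu: "\<lbrakk>runs q e (z # xs) 0; \<And>i. i < z \<Longrightarrow> \<exists>y. runs q e (i # xs) (Suc y)\<rbrakk>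
    \<Longrightarrow> runs q (Mu e) xs z"

inductive_cases runs_elims:
  "runs q Zero xs y"
  "runs q Succ xs y"
  "runs q (Proj i) xs y"
  "runs q Query xs y"
  "runs q (Comp e es) xs y"
  "runs q (PrimRec d e) (0 # xs) y"
  "runs q (PrimRec d e) (Suc n # xs) y"
  "runs q (Mu e) xs y"

lemma runs_deterministic: "runs q e xs y \<Longrightarrow> runs q e xs z \<Longrightarrow> y = z"
proof (induction arbitrary: z rule: runs.induct)
  case (comp xs es ys e y)
  from comp.prems obtain ys' where ys': "list_all2 (\<lambda>e y. runs q e xs y) es ys'" "runs q e ys' z"
    by (rule runs_elims(5))
  have "ys = ys'"
    using comp(1) ys'(1) by (auto simp: list_all2_conv_all_nth intro: nth_equalityI)
  then show ?case using comp ys' by blast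
next
  case (mu e y xs)
  from mu.prems obtain z0: "runs q e (z # xs) 0"
    and zS: "\<And>i. i < z \<Longrightarrow> \<exists>y. runs q e (i # xs) (Suc y)"
    by (rule runs_elims(8)) blast
  have "\<not> y < z"
    using zS mu(2) by fastforce
  moreover have "\<not> z < y"
    using z0 mu(3) by fastforce
  ultimately show ?case by simp
next
  case (primrec_0 d xs y e)
  then show ?case by (blast elim: runs_elims(6))
next
  case (primrec_Suc d e n xs y w)
  from primrec_Suc.prems obtain y' where "runs q (PrimRec d e) (n # xs) y'" "runs q e (n # y' # xs) z"
    by (rule runs_elims(7))
  then show ?case using primrec_Suc.IH by metis
qed (auto elim: runs_elims(1-4))

text \<open>
  The program is only constrained on the domain of \<open>F\<close>, so restrictions of computable
  functions are computable.
\<close>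

definition partial_computable :: "(baire \<rightharpoonup> baire) \<Rightarrow> bool" where
  "partial_computable F \<longleftrightarrow> (\<exists>e. \<forall>q \<in> dom F. \<forall>n. runs q e [n] (the (F q) n))"


section \<open>Medvedev and Turing degrees\<close>

definition medvedev_le :: "baire set \<Rightarrow> baire set \<Rightarrow> bool" (infix \<open>\<le>\<^sub>M\<close> 50) where
  "A \<le>\<^sub>M B \<longleftrightarrow> (\<exists>F. partial_computable F \<and> B \<subseteq> dom F \<and> (the \<circ> F) ` B \<subseteq> A)"

definition medvedev_equiv :: "(baire set \<times> baire set) set" where
  "medvedev_equiv = {(A, B). A \<le>\<^sub>M B \<and> B \<le>\<^sub>M A}"

definition medvedev_degree :: "baire set \<Rightarrow> baire set set" where
  "medvedev_degree A = medvedev_equiv `` {A}"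

definition turing_degrees :: "baire set set set" where
  "turing_degrees = {medvedev_degree {q} | q. True}"

primrec subst_query :: "prog \<Rightarrow> prog \<Rightarrow> prog" where
  "subst_query d Zero = Zero"
| "subst_query d Succ = Succ"
| "subst_query d (Proj i) = Proj i"
| "subst_query d Query = d"
| "subst_query d (Comp e es) = Comp (subst_query d e) (map (subst_query d) es)"
| "subst_query d (PrimRec e e') = PrimRec (subst_query d e) (subst_query d e')"
| "subst_query d (Mu e) = Mu (subst_query d e)"

lemma runs_subst_query:
  assumes "runs r e xs y" and d: "\<And>n. runs q d [n] (r n)"
  shows "runs q (subst_query d e) xs y"
  using assms(1)
proof (induction rule: runs.induct)
  case (comp xs es ys e z)
  have "list_all2 (\<lambda>e y. runs q e xs y) (map (subst_query d) es) ys"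
    using comp(1) by (auto simp: list_all2_conv_all_nth)
  then show ?case using comp by (auto intro: runs.comp)
next
  case (mu e z xs)
  then show ?case by (auto intro!: runs.mu)
next
  case (primrec_Suc e e' n xs y z)
  then show ?case by (auto intro: runs.primrec_Suc)
qed (auto intro: runs.zero runs.succ runs.proj runs.primrec_0 d)

lemma medvedev_le_refl: "A \<le>\<^sub>M A"
proof -
  have "partial_computable Some"
    unfolding partial_computable_def by (rule exI[of _ Query]) (auto intro: runs.query)
  then show ?thesis
    unfolding medvedev_le_def by (intro exI[of _ Some]) auto
qed

lemma medvedev_le_trans:
  assumes "A \<le>\<^sub>M B" "B \<le>\<^sub>M C"
  shows "A \<le>\<^sub>M C"
proof -
  obtain F e where F: "\<forall>q\<in>dom F. \<forall>n. runs q e [n] (the (F q) n)" "B \<subseteq> dom F" "(the \<circ> F) ` B \<subseteq> A"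
    using assms(1) unfolding medvedev_le_def partial_computable_def by blast
  obtain G d where G: "\<forall>q\<in>dom G. \<forall>n. runs q d [n] (the (G q) n)" "C \<subseteq> dom G" "(the \<circ> G) ` C \<subseteq> B"
    using assms(2) unfolding medvedev_le_def partial_computable_def by blast
  have comp: "(F \<circ>\<^sub>m G) q = F (the (G q))" if "q \<in> dom G" for q
    using that by auto
  have C: "the (G q) \<in> B" "q \<in> dom G" if "q \<in> C" for q
    using that G(2,3) by auto
  have "runs q (subst_query d e) [n] (the ((F \<circ>\<^sub>m G) q) n)" if "q \<in> dom (F \<circ>\<^sub>m G)" for q n
  proof -
    have q: "q \<in> dom G" "the (G q) \<in> dom F"
      using that by (auto simp: map_comp_def split: option.splits)
    have "runs q (subst_query d e) [n] (the (F (the (G q))) n)"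
      by (rule runs_subst_query[where r = "the (G q)"]) (use F(1) G(1) q in blast)+
    then show ?thesis using comp q by simp
  qed
  then have "partial_computable (F \<circ>\<^sub>m G)"
    unfolding partial_computable_def by blast
  moreover have "C \<subseteq> dom (F \<circ>\<^sub>m G)"
  proof
    fix q assume "q \<in> C"
    then have "F (the (G q)) \<noteq> None"
      using C F(2) by blast
    then show "q \<in> dom (F \<circ>\<^sub>m G)"
      using comp[OF C(2)[OF \<open>q \<in> C\<close>]] by (simp add: domIff)
  qed
  moreover have "(the \<circ> (F \<circ>\<^sub>m G)) ` C \<subseteq> A"
  proof
    fix r assume "r \<in> (the \<circ> (F \<circ>\<^sub>m G)) ` C"
    then obtain q where q: "q \<in> C" "r = the ((F \<circ>\<^sub>m G) q)"
      by auto
    then have "r = (the \<circ> F) (the (G q))"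
      using comp[OF C(2)] by simp
    then show "r \<in> A"
      using F(3) C(1)[OF q(1)] by blast
  qed
  ultimately show ?thesis unfolding medvedev_le_def by blast
qed

lemma equiv_medvedev: "equiv UNIV medvedev_equiv"
proof (rule equivI)
  show "trans medvedev_equiv"
    unfolding medvedev_equiv_def by (blast intro: transI medvedev_le_trans)
qed (auto simp: medvedev_equiv_def refl_on_def sym_def medvedev_le_refl)


section \<open>Point degree spectra\<close>

text \<open>The standard pairing of Baire space with itself, used to code \<open>{p} \<times> A\<close>.\<close>

definition pair_baire :: "baire \<Rightarrow> baire \<Rightarrow> baire" where
  "pair_baire p q n = (if even n then p (n div 2) else q (n div 2))"

definition point_degree :: "baire \<Rightarrow> (baire \<rightharpoonup> 'a) \<Rightarrow> 'a \<Rightarrow> baire set set" where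
  "point_degree p \<delta> x = medvedev_degree (pair_baire p ` {q. \<delta> q = Some x})"

definition spectrum :: "baire \<Rightarrow> 'a topology \<Rightarrow> (baire \<rightharpoonup> 'a) \<Rightarrow> baire set set set" where
  "spectrum p X \<delta> = point_degree p \<delta> ` topspace X"


section \<open>Countable dimensional spaces\<close>

text \<open>
  Finite dimensionality refers to the small inductive dimension of the library, which on
  separable metrizable spaces agrees with the large inductive and the covering dimension.
\<close>

definition finite_dimensional_space :: "'a topology \<Rightarrow> bool" where
  "finite_dimensional_space X \<longleftrightarrow> (\<exists>n. X dim_le n)"

definition countable_dimensional_space :: "'a topology \<Rightarrow> bool" where
  "countable_dimensional_space X \<longleftrightarrow> (\<exists>\<S>. countable \<S> \<and> \<Union>\<S> = topspace X
     \<and> (\<forall>S \<in> \<S>. finite_dimensional_space (subtopology X S)))"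

end

theory Submission
  imports Defs
begin

text \<open>
  If every point \<open>x\<close> has Turing degree \<open>[{q}]\<close> relative to \<open>p\<close>, then, for each of the countably many
  pairs of programs \<open>(d, e)\<close>, the points for which \<open>d\<close> and \<open>e\<close> witness the equivalence form a
  subspace that \<open>x \<mapsto> q\<close> embeds into Baire space: \<open>d\<close> makes this map continuous, by lifting convergent
  sequences to names, and \<open>e\<close> makes its inverse continuous. So \<open>X\<close> is a countable union of
  zero-dimensional subspaces.

  Conversely, removing from a space of dimension \<open>n\<close> the frontiers of a countable base, which have
  dimension at most \<open>n - 1\<close>, leaves a zero-dimensional space. By induction, without any sum theorem, a
  countable dimensional \<open>X\<close> is a countable union of spaces \<open>Z\<^sub>k\<close> with embeddings \<open>h\<^sub>k\<close> into Baire space.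
  Admissibility gives continuous \<open>G\<^sub>k\<close> that send \<open>h\<^sub>k x\<close> to a name of \<open>x\<close>, and \<open>H\<^sub>k = h\<^sub>k \<circ> \<delta>\<close> goes back.
  An oracle \<open>p\<close> that tabulates moduli and values of all \<open>G\<^sub>k\<close> and \<open>H\<^sub>k\<close> makes them computable, so
  \<open>deg\<^sup>p(x)\<close> is the degree of \<open>p \<oplus> h\<^sub>k x\<close>.
\<close>


section \<open>Programs\<close>

text \<open>Countability of programs makes the family of pieces indexed by pairs of reductions
  countable.\<close>

instance prog :: countable
  by countable_datatype

text \<open>The sets \<open>{q'. agree m q q'}\<close> are the basic open cylinders of Baire space;
  moduli of continuity are expressed through them.\<close>

definition agree :: "nat \<Rightarrow> baire \<Rightarrow> baire \<Rightarrow> bool" where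
  "agree m q q' \<longleftrightarrow> (\<forall>i<m. q i = q' i)"

lemma agree_refl [simp]: "agree m q q"
  by (simp add: agree_def)

lemma agree_mono: "agree m q q' \<Longrightarrow> k \<le> m \<Longrightarrow> agree k q q'"
  by (simp add: agree_def)

lemma finite_use:
  assumes "\<And>i::nat. i < k \<Longrightarrow> \<exists>m. \<forall>q'. agree m q q' \<longrightarrow> P i q'"
  shows "\<exists>m. \<forall>q'. agree m q q' \<longrightarrow> (\<forall>i<k. P i q')"
proof -
  obtain m where m: "\<And>i q'. i < k \<Longrightarrow> agree (m i) q q' \<Longrightarrow> P i q'"
    using assms by metis
  \<comment> \<open>The sum serves as a common bound: it dominates every \<open>m i\<close> and is
    defined for \<open>k = 0\<close>.\<close>
  have "P i q'" if "agree (\<Sum>i<k. m i) q q'" "i < k" for i q'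
    using m[OF that(2)] agree_mono[OF that(1)] member_le_sum[of i "{..<k}" m] that(2) by auto
  then show ?thesis by blast
qed

text \<open>The use principle: a halting computation consults only finitely many oracle
  values.\<close>

lemma runs_use: "runs q e xs y \<Longrightarrow> \<exists>m. \<forall>q'. agree m q q' \<longrightarrow> runs q' e xs y"
proof (induction rule: runs.induct)
  case (query x)
  have "runs q' Query [x] (q x)" if "agree (Suc x) q q'" for q'
    using that runs.query[of q' x] by (simp add: agree_def)
  then show ?case by blast
next
  case (comp xs es ys e z)
  obtain m1 where m1: "\<forall>q'. agree m1 q q' \<longrightarrow> runs q' e ys z"
    using comp.IH by blast
  have "\<exists>m. \<forall>q'. agree m q q' \<longrightarrow> (\<forall>i<length es. runs q' (es ! i) xs (ys ! i))"
    using comp.IH(1) by (intro finite_use) (auto simp: list_all2_conv_all_nth)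
  then obtain m2 where m2: "\<forall>q'. agree m2 q q' \<longrightarrow> (\<forall>i<length es. runs q' (es ! i) xs (ys ! i))"
    by blast
  have "runs q' (Comp e es) xs z" if "agree (max m1 m2) q q'" for q'
  proof (rule runs.comp)
    show "list_all2 (\<lambda>e y. runs q' e xs y) es ys"
      using comp.IH(1) m2 agree_mono[OF that, of m2] by (auto simp: list_all2_conv_all_nth)
    show "runs q' e ys z"
      using m1 agree_mono[OF that, of m1] by simp
  qed
  then show ?case by blast
next
  case (primrec_Suc d e n xs y z)
  then obtain m1 m2 where m: "\<And>q'. agree m1 q q' \<Longrightarrow> runs q' (PrimRec d e) (n # xs) y"
    "\<And>q'. agree m2 q q' \<Longrightarrow> runs q' e (n # y # xs) z"
    by blast
  have "runs q' (PrimRec d e) (Suc n # xs) z" if "agree (max m1 m2) q q'" for q'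
    using m agree_mono[OF that, of m1] agree_mono[OF that, of m2]
    by (auto intro: runs.primrec_Suc)
  then show ?case by blast
next
  case (mu e z xs)
  obtain m1 where m1: "\<forall>q'. agree m1 q q' \<longrightarrow> runs q' e (z # xs) 0"
    using mu.IH by blast
  \<comment> \<open>Only the finitely many tests below \<open>z\<close> are run, so their uses have
    a common bound.\<close>
  have "\<exists>m. \<forall>q'. agree m q q' \<longrightarrow> (\<forall>i<z. \<exists>y. runs q' e (i # xs) (Suc y))"
    using mu.IH(2) by (intro finite_use) blast
  then obtain m2 where m2: "\<forall>q'. agree m2 q q' \<longrightarrow> (\<forall>i<z. \<exists>y. runs q' e (i # xs) (Suc y))"
    by blast
  have "runs q' (Mu e) xs z" if "agree (max m1 m2) q q'" for q'
    using m1 m2 agree_mono[OF that, of m1] agree_mono[OF that, of m2]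
    by (auto intro: runs.mu)
  then show ?case by blast
qed (auto intro: runs.intros)

lemma runs_use_all:
  assumes "\<And>n. n < k \<Longrightarrow> runs q e [n] (r n)"
  shows "\<exists>m. \<forall>q'. agree m q q' \<longrightarrow> (\<forall>n<k. runs q' e [n] (r n))"
  using runs_use[OF assms] by (rule finite_use)

section \<open>Programs for arithmetic, pairing and parity\<close>

lemma runs_proj': "\<lbrakk>i < length xs; xs ! i = y\<rbrakk> \<Longrightarrow> runs q (Proj i) xs y"
  using runs.proj by blast

lemma runs_query': "q x = y \<Longrightarrow> runs q Query [x] y"
  using runs.query by blast

lemma runs_comp1: "\<lbrakk>runs q a xs y; runs q e [y] z\<rbrakk> \<Longrightarrow> runs q (Comp e [a]) xs z"
  by (rule runs.comp[of q xs "[a]" "[y]"]) auto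

lemma runs_comp2:
  "\<lbrakk>runs q a xs y; runs q b xs y'; runs q e [y, y'] z\<rbrakk> \<Longrightarrow> runs q (Comp e [a, b]) xs z"
  by (rule runs.comp[of q xs "[a, b]" "[y, y']"]) auto

lemma runs_comp3:
  "\<lbrakk>runs q a xs y; runs q b xs y'; runs q c xs y''; runs q e [y, y', y''] z\<rbrakk>
    \<Longrightarrow> runs q (Comp e [a, b, c]) xs z"
  by (rule runs.comp[of q xs "[a, b, c]" "[y, y', y'']"]) auto

lemma runs_primrec:
  assumes "runs q d xs (f 0)" and "\<And>n. runs q e (n # f n # xs) (f (Suc n))"
  shows "runs q (PrimRec d e) (n # xs) (f n)"
  by (induction n) (use assms in \<open>auto intro: runs.primrec_0 runs.primrec_Suc\<close>)

definition add_prog :: prog where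
  "add_prog = PrimRec (Proj 0) (Comp Succ [Proj 1])"

lemma runs_add: "runs q add_prog [a, b] (a + b)"
  unfolding add_prog_def
  by (rule runs_primrec[where f = "\<lambda>n. n + b"])
    (auto intro!: runs_proj' runs_comp1 runs.succ)

definition mult_prog :: prog where
  "mult_prog = PrimRec Zero (Comp add_prog [Proj 1, Proj 2])"

lemma runs_mult: "runs q mult_prog [a, b] (a * b)"
  unfolding mult_prog_def
proof (rule runs_primrec[where f = "\<lambda>n. n * b"])
  fix n
  have "runs q (Comp add_prog [Proj 1, Proj 2]) [n, n * b, b] (n * b + b)"
    by (rule runs_comp2[OF _ _ runs_add]) (auto intro: runs_proj')
  then show "runs q (Comp add_prog [Proj 1, Proj 2]) [n, n * b, b] (Suc n * b)"
    by (simp add: add.commute)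
qed (auto intro: runs.zero)

definition double_prog :: prog where
  "double_prog = Comp add_prog [Proj 0, Proj 0]"

lemma runs_double: "runs q double_prog [a] (2 * a)"
  unfolding double_prog_def mult_2 by (rule runs_comp2[OF _ _ runs_add]) (auto intro: runs_proj')

primrec const_prog :: "nat \<Rightarrow> prog" where
  "const_prog 0 = Zero"
| "const_prog (Suc k) = Comp Succ [const_prog k]"

lemma runs_const: "runs q (const_prog k) xs k"
  by (induction k) (auto intro: runs.zero runs.succ runs_comp1)

text \<open>\<open>code\<close> is an injective pairing: with \<open>s = a + b\<close> its value lies in \<open>[s\<^sup>2, (s + 1)\<^sup>2)\<close>.\<close>

definition code :: "nat \<Rightarrow> nat \<Rightarrow> nat" where
  "code a b = (a + b) * (a + b) + a"

lemma code_less: "a + b < c + d \<Longrightarrow> code a b < code c d"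
proof -
  assume "a + b < c + d"
  then have "Suc (a + b) * Suc (a + b) \<le> (c + d) * (c + d)"
    by (intro mult_le_mono) auto
  then show ?thesis
    by (simp add: code_def)
qed

lemma code_inject [simp]: "code a b = code c d \<longleftrightarrow> a = c \<and> b = d"
proof
  assume eq: "code a b = code c d"
  then have s: "a + b = c + d"
    using code_less[of a b c d] code_less[of c d a b] by (metis less_irrefl nat_neq_iff)
  with eq have "a = c"
    unfolding code_def s by simp
  with s show "a = c \<and> b = d" by simp
qed simp

definition code_prog :: prog where
  "code_prog = Comp add_prog [Comp mult_prog [add_prog, add_prog], Proj 0]"

lemma runs_code: "runs q code_prog [a, b] (code a b)"
  unfolding code_prog_def code_def
  by (rule runs_comp2[OF _ _ runs_add] runs_comp2[OF _ _ runs_mult])+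
    (auto intro: runs_proj' runs_add)

lemma runs_code_comp:
  "\<lbrakk>runs q a xs y; runs q b xs z\<rbrakk> \<Longrightarrow> runs q (Comp code_prog [a, b]) xs (code y z)"
  by (rule runs_comp2[OF _ _ runs_code])

definition not_prog :: prog where
  "not_prog = PrimRec (const_prog 1) Zero"

lemma runs_not: "runs q not_prog [a] (if a = 0 then 1 else 0)"
  unfolding not_prog_def
  by (rule runs_primrec[where f = "\<lambda>a. if a = 0 then 1 else 0"])
    (auto simp: runs_const[of _ 1, simplified] intro: runs.zero)

definition even_prog :: prog where
  "even_prog = PrimRec (const_prog 1) (Comp not_prog [Proj 1])"

lemma runs_even: "runs q even_prog [n] (if even n then 1 else 0)"
  unfolding even_prog_def
proof (rule runs_primrec[where f = "\<lambda>n. if even n then 1 else 0"])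
  fix n
  show "runs q (Comp not_prog [Proj 1]) [n, if even n then 1 else 0] (if even (Suc n) then 1 else 0)"
    using runs_not[of q "if even n then 1 else 0"] by (auto intro!: runs_comp1 runs_proj')
qed (simp add: runs_const[of _ 1, simplified])

lemma pair_baire_double [simp]: "pair_baire p q (2 * n) = p n"
  and pair_baire_Suc_double [simp]: "pair_baire p q (Suc (2 * n)) = q n"
  by (simp_all add: pair_baire_def)


section \<open>An oracle for countably many continuous functions\<close>

text \<open>A code of the prefix of length \<open>m\<close>. The length cannot be read off from it
  (zero prefixes of lengths 0 and 1 both have code 0), so \<open>entry\<close> records it
  separately.\<close>

primrec hist :: "baire \<Rightarrow> nat \<Rightarrow> nat" where
  "hist q 0 = 0"
| "hist q (Suc m) = code (hist q m) (q m)"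

lemma hist_eq_iff: "hist q m = hist q' m \<longleftrightarrow> agree m q q'"
  by (induction m) (auto simp: agree_def less_Suc_eq)

text \<open>The second component of the pair sits at the odd positions, hence the successor of the
  doubled index.\<close>

definition hist_prog :: prog where
  "hist_prog = PrimRec Zero
     (Comp code_prog [Proj 1, Comp Query [Comp Succ [Comp double_prog [Proj 0]]]])"

lemma runs_hist: "runs (pair_baire p q) hist_prog [m] (hist q m)"
  unfolding hist_prog_def
  by (rule runs_primrec[where f = "hist q"])
    (auto intro!: runs.zero runs_code_comp runs_proj'
      runs_comp1[OF runs_comp1[OF runs_comp1[OF _ runs_double] runs.succ] runs_query'])

text \<open>If \<open>q\<close> lies in \<open>dom F\<close>, at most one \<open>v\<close>
  qualifies, since \<open>q\<close> extends its own prefix. If the cylinder misses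
  \<open>dom F\<close>, every \<open>v\<close> does.\<close>

definition determines :: "(baire \<rightharpoonup> baire) \<Rightarrow> baire \<Rightarrow> nat \<Rightarrow> nat \<Rightarrow> nat \<Rightarrow> bool" where
  "determines F q m i v \<longleftrightarrow> (\<forall>q'\<in>dom F. agree m q q' \<longrightarrow> the (F q') i = v)"

text \<open>Only the prefix of \<open>q\<close> matters, so this information can be tabulated by
  codes of prefixes.\<close>

lemma determines_cong: "agree m q q' \<Longrightarrow> determines F q m i v = determines F q' m i v"
  unfolding determines_def agree_def by auto

text \<open>
  The entry for \<open>v = 0\<close> says whether the prefix of \<open>q\<close> of length \<open>m\<close> determines a value of
  \<open>F k\<close>, the entry for \<open>Suc v\<close> whether it determines the value \<open>v\<close>. Arguments are halved because
  the values of \<open>F k q\<close> are the odd values of a pair.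
\<close>

definition table_rel :: "(nat \<Rightarrow> baire \<rightharpoonup> baire) \<Rightarrow> nat \<Rightarrow> nat \<Rightarrow> nat \<Rightarrow> nat \<Rightarrow> baire \<Rightarrow> bool" where
  "table_rel F v m n k q = (case v of
      0 \<Rightarrow> \<exists>u. determines (F k) q m (n div 2) u
    | Suc u \<Rightarrow> determines (F k) q m (n div 2) u)"

definition entry :: "nat \<Rightarrow> nat \<Rightarrow> nat \<Rightarrow> nat \<Rightarrow> baire \<Rightarrow> nat" where
  "entry v m n k q = code v (code m (code n (code k (hist q m))))"

text \<open>Truth is coded by 0, so that \<open>Mu\<close> can search the table directly.\<close>

definition table :: "(nat \<Rightarrow> baire \<rightharpoonup> baire) \<Rightarrow> baire" where
  "table F x = (if \<exists>v m n k q. x = entry v m n k q \<and> table_rel F v m n k q then 0 else 1)"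

lemma range_table: "range (table F) \<subseteq> {0, 1}"
  by (auto simp: table_def)

text \<open>Injectivity of \<open>code\<close> recovers every argument of the entry except
  \<open>q\<close>, of which the prefix remains; by \<open>determines_cong\<close> the choice of
  \<open>q\<close> does not affect the answer.\<close>

lemma table_entry: "table F (entry v m n k q) = (if table_rel F v m n k q then 0 else 1)"
proof -
  have "table_rel F v m n k q"
    if "entry v m n k q = entry v' m' n' k' q'" "table_rel F v' m' n' k' q'" for v' m' n' k' q'
    using that determines_cong[of m q q']
    by (auto simp: entry_def table_rel_def hist_eq_iff split: nat.splits)
  then show ?thesis
    unfolding table_def by auto
qed

text \<open>The address is doubled because the table occupies the even positions of the
  oracle.\<close>

definition entry_prog :: "nat \<Rightarrow> prog" where
  "entry_prog k = Comp Query [Comp double_prog [Comp code_prog [Proj 0, Comp code_prog [Proj 1,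
     Comp code_prog [Proj 2, Comp code_prog [const_prog k, Comp hist_prog [Proj 1]]]]]]]"

lemma runs_entry: "runs (pair_baire p q) (entry_prog k) [v, m, n] (p (entry v m n k q))"
  unfolding entry_prog_def
  by (rule runs_comp1[OF runs_comp1[OF _ runs_double] runs_query'])
    (auto simp: entry_def intro!: runs_code_comp runs_proj' runs_const runs_comp1[OF _ runs_hist])

definition length_prog :: "nat \<Rightarrow> prog" where
  "length_prog k = Mu (Comp (entry_prog k) [Zero, Proj 0, Proj 1])"

definition value_prog :: "nat \<Rightarrow> prog" where
  "value_prog k = Comp (Mu (Comp (entry_prog k) [Comp Succ [Proj 0], Proj 1, Proj 2]))
     [length_prog k, Proj 0]"

text \<open>Two searches in the table: first for the least prefix length that settles the value,
  then for the value settled by that prefix. Continuity of \<open>F k\<close> at \<open>q\<close>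
  makes the first one stop.\<close>

lemma runs_value:
  assumes q: "q \<in> dom (F k)" and "\<exists>m. determines (F k) q m (n div 2) (the (F k q) (n div 2))"
  shows "runs (pair_baire (table F) q) (value_prog k) [n] (the (F k q) (n div 2))"
proof -
  let ?r = "pair_baire (table F) q" and ?y = "the (F k q) (n div 2)"
  define m where "m = (LEAST m. \<exists>u. determines (F k) q m (n div 2) u)"
  have "\<exists>u. determines (F k) q m (n div 2) u"
    unfolding m_def by (rule LeastI_ex) (use assms(2) in blast)
  \<comment> \<open>\<open>q\<close> itself is among the points that the prefix speaks
    about.\<close>
  moreover have det: "u = ?y" if "determines (F k) q m (n div 2) u" for u
    using that q unfolding determines_def by auto
  ultimately have m: "determines (F k) q m (n div 2) ?y"
    by blast
  have less_m: "\<not> determines (F k) q i (n div 2) u" if "i < m" for i u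
    using that not_less_Least unfolding m_def by blast
  have m': "runs ?r (Comp (entry_prog k) [Zero, Proj 0, Proj 1]) [i, n]
      (if \<exists>u. determines (F k) q i (n div 2) u then 0 else 1)" for i
    by (rule runs_comp3[OF runs.zero runs_proj' runs_proj'])
      (use runs_entry[of "table F" q k 0 i n] in \<open>auto simp: table_entry table_rel_def\<close>)
  have "runs ?r (length_prog k) [n] m"
    unfolding length_prog_def
  proof (rule runs.mu)
    show "runs ?r (Comp (entry_prog k) [Zero, Proj 0, Proj 1]) [m, n] 0"
      using m'[of m] m by (auto split: if_splits)
    show "\<exists>y. runs ?r (Comp (entry_prog k) [Zero, Proj 0, Proj 1]) [i, n] (Suc y)" if "i < m" for i
      using m'[of i] less_m[OF that] by auto
  qed
  moreover have v': "runs ?r (Comp (entry_prog k) [Comp Succ [Proj 0], Proj 1, Proj 2]) [i, m, n]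
      (if determines (F k) q m (n div 2) i then 0 else 1)" for i
    by (rule runs_comp3[OF runs_comp1[OF runs_proj' runs.succ] runs_proj' runs_proj'])
      (use runs_entry[of "table F" q k "Suc i" m n] in \<open>auto simp: table_entry table_rel_def\<close>)
  \<comment> \<open>Only the correct value passes the test: by \<open>det\<close>, an accepted
    \<open>i\<close> equals \<open>?y\<close>.\<close>
  have "runs ?r (Mu (Comp (entry_prog k) [Comp Succ [Proj 0], Proj 1, Proj 2])) [m, n] ?y"
  proof (rule runs.mu)
    show "runs ?r (Comp (entry_prog k) [Comp Succ [Proj 0], Proj 1, Proj 2]) [?y, m, n] 0"
      using v'[of ?y] m by simp
    show "\<exists>y. runs ?r (Comp (entry_prog k) [Comp Succ [Proj 0], Proj 1, Proj 2]) [i, m, n] (Suc y)"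
      if "i < ?y" for i
      using v'[of i] det[of i] that by (auto split: if_splits)
  qed
  ultimately show ?thesis
    unfolding value_prog_def by (intro runs_comp2) (auto intro: runs_proj')
qed

text \<open>A case distinction by arithmetic: both branches run on every argument and the wrong one
  is multiplied by 0. So \<open>value_prog\<close> has to halt on even arguments as well, which its
  use of \<open>n div 2\<close> ensures.\<close>

definition pair_prog :: "nat \<Rightarrow> prog" where
  "pair_prog k = Comp add_prog
     [Comp mult_prog [even_prog, Query], Comp mult_prog [Comp not_prog [even_prog], value_prog k]]"

lemma runs_pair:
  assumes "q \<in> dom (F k)" and "\<And>i. \<exists>m. determines (F k) q m i (the (F k q) i)"
  shows "runs (pair_baire (table F) q) (pair_prog k) [n] (pair_baire (table F) (the (F k q)) n)"
proof -
  let ?e = "if even n then 1 else 0 :: nat"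
  have "runs (pair_baire (table F) q) (pair_prog k) [n]
     (?e * pair_baire (table F) q n + (if ?e = 0 then 1 else 0) * the (F k q) (n div 2))"
    unfolding pair_prog_def
    by (intro runs_comp2[OF _ _ runs_add] runs_comp2[OF _ _ runs_mult] runs_even runs.query
        runs_comp1[OF runs_even runs_not] runs_value assms)
  then show ?thesis
    by (simp add: pair_baire_def split: if_splits)
qed

text \<open>A program with choosable outputs carries the same information as a partial computable
  function: choosing outputs on \<open>B\<close> and restricting to \<open>B\<close> rebuilds the
  function.\<close>

lemma medvedev_le_iff:
  "A \<le>\<^sub>M B \<longleftrightarrow> (\<exists>e. \<forall>r\<in>B. \<exists>s\<in>A. \<forall>n. runs r e [n] (s n))"
proof
  assume "A \<le>\<^sub>M B"
  then obtain F e where F: "\<forall>q\<in>dom F. \<forall>n. runs q e [n] (the (F q) n)" "B \<subseteq> dom F" "(the \<circ> F) ` B \<subseteq> A"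
    unfolding medvedev_le_def partial_computable_def by blast
  then have "\<forall>r\<in>B. the (F r) \<in> A \<and> (\<forall>n. runs r e [n] (the (F r) n))"
    by auto
  then show "\<exists>e. \<forall>r\<in>B. \<exists>s\<in>A. \<forall>n. runs r e [n] (s n)"
    by blast
next
  assume "\<exists>e. \<forall>r\<in>B. \<exists>s\<in>A. \<forall>n. runs r e [n] (s n)"
  then obtain e f where f: "\<forall>r\<in>B. f r \<in> A \<and> (\<forall>n. runs r e [n] (f r n))"
    by metis
  have "partial_computable ((Some \<circ> f) |` B)"
    unfolding partial_computable_def by (rule exI[of _ e]) (use f in auto)
  moreover have "B \<subseteq> dom ((Some \<circ> f) |` B)" "(the \<circ> ((Some \<circ> f) |` B)) ` B \<subseteq> A"
    using f by auto
  ultimately show "A \<le>\<^sub>M B"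
    unfolding medvedev_le_def by blast
qed

lemma medvedev_degree_eq_iff: "medvedev_degree A = medvedev_degree B \<longleftrightarrow> A \<le>\<^sub>M B \<and> B \<le>\<^sub>M A"
  unfolding medvedev_degree_def using eq_equiv_class_iff[OF equiv_medvedev, of A B]
  by (simp add: medvedev_equiv_def)


section \<open>Continuity on Baire space\<close>

lemma open_agree: "open {q'. agree m q q'}"
proof -
  have "{q'. agree m q q'} = (\<Inter>i\<in>{..<m}. (\<lambda>q'. q' i) -` {q i})"
    by (auto simp: agree_def)
  moreover have "open ((\<lambda>q' :: baire. q' i) -` {q i})" for i
    by (rule open_vimage) (auto intro: open_discrete continuous_on_product_coordinates)
  ultimately show ?thesis
    by auto
qed

lemma open_baire_iff: "open U \<longleftrightarrow> (\<forall>q\<in>U. \<exists>m. \<forall>q'. agree m q q' \<longrightarrow> q' \<in> U)"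
proof
  assume U: "open (U :: baire set)"
  show "\<forall>q\<in>U. \<exists>m. \<forall>q'. agree m q q' \<longrightarrow> q' \<in> U"
  proof
    fix q assume "q \<in> U"
    moreover have "openin (product_topology (\<lambda>i. euclidean) UNIV) U"
      using U by (simp add: euclidean_product_topology)
    ultimately obtain W where W: "finite {i. W i \<noteq> UNIV}" "q \<in> Pi\<^sub>E UNIV W" "Pi\<^sub>E UNIV W \<subseteq> U"
      unfolding openin_product_topology_alt by fastforce
    \<comment> \<open>A basic open box constrains finitely many coordinates, so a long enough prefix
      controls it.\<close>
    then obtain m where m: "\<And>i. W i \<noteq> UNIV \<Longrightarrow> i < m"
      using finite_nat_set_iff_bounded by auto
    have "q' \<in> U" if "agree m q q'" for q'
    proof -
      have "q i \<in> W i" for i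
        using W(2) by (auto simp: PiE_iff)
      then have "q' i \<in> W i" for i
        using that m[of i] unfolding agree_def by (metis UNIV_I)
      then show ?thesis using W(3) by blast
    qed
    then show "\<exists>m. \<forall>q'. agree m q q' \<longrightarrow> q' \<in> U" by blast
  qed
next
  assume *: "\<forall>q\<in>U. \<exists>m. \<forall>q'. agree m q q' \<longrightarrow> q' \<in> U"
  show "open U"
  proof (subst open_subopen, rule ballI)
    fix q assume "q \<in> U"
    then obtain m where "\<forall>q'. agree m q q' \<longrightarrow> q' \<in> U"
      using * by blast
    then show "\<exists>T. open T \<and> q \<in> T \<and> T \<subseteq> U"
      by (intro exI[of _ "{q'. agree m q q'}"]) (auto simp: open_agree)
  qed
qed

lemma partial_continuous_baire_iff:
  "partial_continuous euclidean X f \<longleftrightarrow> (\<forall>q\<in>dom f. the (f q) \<in> topspace X)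
     \<and> (\<forall>V. \<forall>q\<in>dom f. openin X V \<longrightarrow> the (f q) \<in> V \<longrightarrow>
          (\<exists>m. \<forall>q'\<in>dom f. agree m q q' \<longrightarrow> the (f q') \<in> V))"
  (is "?L \<longleftrightarrow> ?A \<and> ?B")
proof
  assume L: ?L
  then have cont: "continuous_map (subtopology euclidean (dom f)) X (the \<circ> f)"
    by (simp add: partial_continuous_def)
  have ?A
    using continuous_map_image_subset_topspace[OF cont] by auto
  moreover have ?B
  proof (intro allI ballI impI)
    fix V q assume V: "openin X V" and q: "q \<in> dom f" "the (f q) \<in> V"
    have "openin (subtopology euclidean (dom f)) {q \<in> dom f. the (f q) \<in> V}"
      using openin_continuous_map_preimage[OF cont V] by simp
    then obtain T where T: "open T" "{q \<in> dom f. the (f q) \<in> V} = T \<inter> dom f"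
      unfolding openin_subtopology by auto
    then obtain m where "\<forall>q'. agree m q q' \<longrightarrow> q' \<in> T"
      using q unfolding open_baire_iff by blast
    then show "\<exists>m. \<forall>q'\<in>dom f. agree m q q' \<longrightarrow> the (f q') \<in> V"
      using T(2) by blast
  qed
  ultimately show "?A \<and> ?B" by blast
next
  assume AB: "?A \<and> ?B"
  have "openin (subtopology euclidean (dom f)) {q \<in> dom f. the (f q) \<in> V}" if V: "openin X V" for V
  proof -
    let ?S = "{q \<in> dom f. the (f q) \<in> V}"
    have "\<forall>q\<in>?S. \<exists>m. \<forall>q'\<in>dom f. agree m q q' \<longrightarrow> the (f q') \<in> V"
      using AB V by (simp add: domIff)
    then obtain m where m: "\<forall>q\<in>?S. \<forall>q'\<in>dom f. agree (m q) q q' \<longrightarrow> the (f q') \<in> V"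
      by (rule bchoice[THEN exE])
    \<comment> \<open>A union of cylinders inside Baire space whose trace on \<open>dom f\<close> is
      the preimage of \<open>V\<close>.\<close>
    define T where "T = (\<Union>q\<in>?S. {q'. agree (m q) q q'})"
    have "open T"
      unfolding T_def by (rule open_UN) (simp add: open_agree)
    moreover have "?S = T \<inter> dom f"
      using m unfolding T_def by auto
    ultimately show ?thesis
      unfolding openin_subtopology by (metis open_openin)
  qed
  then show ?L
    unfolding partial_continuous_def continuous_map_def using AB by (simp add: Pi_iff)
qed

lemma partial_continuous_baireD:
  assumes "partial_continuous euclidean X f" "q \<in> dom f" "openin X V" "the (f q) \<in> V"
  shows "\<exists>m. \<forall>q'\<in>dom f. agree m q q' \<longrightarrow> the (f q') \<in> V"
  using conjunct2[OF assms(1)[unfolded partial_continuous_baire_iff], rule_format, OF assms(2-4)] .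

lemma partial_continuous_agree:
  assumes "partial_continuous euclidean euclidean F" "q \<in> dom F"
  shows "\<exists>k. \<forall>q'\<in>dom F. agree k q q' \<longrightarrow> agree m (the (F q)) (the (F q'))"
  using partial_continuous_baireD[OF assms, of "{s. agree m (the (F q)) s}"] open_agree by simp

lemma partial_continuous_determines:
  assumes "partial_continuous euclidean euclidean F" "q \<in> dom F"
  shows "\<exists>m. determines F q m i (the (F q) i)"
proof -
  \<comment> \<open>\<open>Suc i\<close> is the least length whose prefix includes position
    \<open>i\<close>.\<close>
  obtain m where "\<forall>q'\<in>dom F. agree m q q' \<longrightarrow> agree (Suc i) (the (F q)) (the (F q'))"
    using partial_continuous_agree[OF assms] by blast
  then have "determines F q m i (the (F q) i)"
    unfolding determines_def agree_def by simp
  then show ?thesis ..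
qed

lemma partial_continuous_baireI:
  assumes "\<And>q m. q \<in> dom F \<Longrightarrow> \<exists>k. \<forall>q'\<in>dom F. agree k q q' \<longrightarrow> agree m (the (F q)) (the (F q'))"
  shows "partial_continuous euclidean euclidean F"
  unfolding partial_continuous_baire_iff
proof (intro conjI allI ballI impI)
  fix V q assume q: "q \<in> dom F" and V: "openin euclidean V" "the (F q) \<in> V"
  then obtain m where m: "\<forall>s. agree m (the (F q)) s \<longrightarrow> s \<in> V"
    unfolding open_openin[symmetric] open_baire_iff by meson
  then show "\<exists>m. \<forall>q'\<in>dom F. agree m q q' \<longrightarrow> the (F q') \<in> V"
    using assms[OF q, of m] by blast
qed auto


section \<open>Countable clopen bases\<close>

lemma metrizable_separable_imp_second_countable:
  assumes "metrizable_space X" "separable_space X"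
  shows "second_countable X"
proof -
  obtain M d where "Metric_space M d" and X: "X = Metric_space.mtopology M d"
    using assms(1) unfolding metrizable_space_def by blast
  then interpret Metric_space M d by simp
  obtain D where D: "countable D" "D \<subseteq> M" "mtopology closure_of D = M"
    using assms(2) unfolding X separable_space_def by auto
  let ?B = "(\<lambda>(a, n). mball a (inverse (real (Suc n)))) ` (D \<times> UNIV)"
  have "\<exists>W\<in>?B. x \<in> W \<and> W \<subseteq> U" if U: "openin mtopology U" "x \<in> U" for U x
  proof -
    obtain r where r: "r > 0" "mball x r \<subseteq> U" and xM: "x \<in> M"
      using U unfolding openin_mtopology by (metis subsetD)
    \<comment> \<open>Half of \<open>r\<close> leaves room for both the distance from
      \<open>x\<close> to a centre \<open>a\<close> and the radius of the ball around
      \<open>a\<close>.\<close>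
    obtain n where n: "inverse (real (Suc n)) < r / 2"
      using reals_Archimedean[of "r / 2"] r by auto
    have "x \<in> mtopology closure_of D"
      using D xM by simp
    then obtain a where a: "a \<in> D" "a \<in> mball x (inverse (real (Suc n)))"
      unfolding metric_closure_of by (auto dest!: spec[of _ "inverse (real (Suc n))"])
    have "mball a (inverse (real (Suc n))) \<subseteq> mball x r"
      by (rule mball_subset) (use a n commute in auto)
    then show ?thesis
      using a r xM commute by (intro bexI[of _ "mball a (inverse (real (Suc n)))"]) auto
  qed
  then show ?thesis
    unfolding second_countable_def X using D(1) by (intro exI[of _ ?B]) auto
qed

text \<open>The form of zero-dimensionality that yields an embedding into Baire space.\<close>

definition clopen_base :: "'a topology \<Rightarrow> 'a set set \<Rightarrow> bool" where
  "clopen_base X \<B> \<longleftrightarrow> countable \<B> \<and> (\<forall>U\<in>\<B>. openin X U \<and> closedin X U)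
     \<and> (\<forall>V x. openin X V \<longrightarrow> x \<in> V \<longrightarrow> (\<exists>U\<in>\<B>. x \<in> U \<and> U \<subseteq> V))"

text \<open>Thins a base of sets with property \<open>P\<close> to a countable one: for each pair
  \<open>(C, D)\<close> from a countable base that admits such a set between \<open>C\<close> and
  \<open>D\<close>, one is chosen. Given \<open>x\<close> in \<open>V\<close>, taking
  \<open>D\<close> inside \<open>V\<close>, then a \<open>P\<close>-set inside \<open>D\<close>,
  then \<open>C\<close> inside that set yields a usable pair.\<close>

lemma second_countable_subbase:
  assumes "second_countable X"
    and P: "\<And>V x. openin X V \<Longrightarrow> x \<in> V \<Longrightarrow> \<exists>U. x \<in> U \<and> U \<subseteq> V \<and> openin X U \<and> P U"
  obtains \<B> where "countable \<B>" "\<And>U. U \<in> \<B> \<Longrightarrow> openin X U \<and> P U"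
    "\<And>V x. openin X V \<Longrightarrow> x \<in> V \<Longrightarrow> \<exists>U\<in>\<B>. x \<in> U \<and> U \<subseteq> V"
proof -
  obtain \<C> where \<C>: "countable \<C>" "\<And>V. V \<in> \<C> \<Longrightarrow> openin X V"
    and base: "\<And>V x. openin X V \<Longrightarrow> x \<in> V \<Longrightarrow> \<exists>U\<in>\<C>. x \<in> U \<and> U \<subseteq> V"
    using assms(1) by (auto simp: second_countable_def)
  let ?Q = "\<lambda>(C, D) U. C \<subseteq> U \<and> U \<subseteq> D \<and> openin X U \<and> P U"
  let ?I = "{c \<in> \<C> \<times> \<C>. \<exists>U. ?Q c U}"
  define u where "u c = (SOME U. ?Q c U)" for c
  have u: "?Q c (u c)" if "c \<in> ?I" for c
    unfolding u_def by (rule someI_ex) (use that in blast)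
  show ?thesis
  proof
    show "countable (u ` ?I)"
      using \<C>(1) by (intro countable_image countable_subset[of ?I "\<C> \<times> \<C>"]) auto
    show "openin X U \<and> P U" if U: "U \<in> u ` ?I" for U
    proof -
      obtain c where c: "c \<in> ?I" "U = u c"
        using U by (rule imageE)
      show ?thesis
        using u[OF c(1)] unfolding c(2) by (simp add: case_prod_unfold)
    qed
    show "\<exists>U\<in>u ` ?I. x \<in> U \<and> U \<subseteq> V" if V: "openin X V" "x \<in> V" for V x
    proof -
      obtain D where D: "D \<in> \<C>" "x \<in> D" "D \<subseteq> V"
        using base[OF V] by blast
      obtain U where U: "x \<in> U" "U \<subseteq> D" "openin X U" "P U"
        using P[OF \<C>(2)[OF D(1)] D(2)] by blast
      obtain C where C: "C \<in> \<C>" "x \<in> C" "C \<subseteq> U"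
        using base[OF U(3,1)] by blast
      have I: "(C, D) \<in> ?I"
        using C D U by blast
      show ?thesis
        using u[OF I] C(2) D(3) by (intro bexI[OF _ imageI[OF I]]) auto
    qed
  qed
qed

text \<open>The frontiers of a suitable countable base decompose by induction; the one new piece
  \<open>Z\<^sub>0\<close> is what remains after removing them. The empty space satisfies the single
  inductive case vacuously.\<close>

lemma dim_le_imp_countable_union_clopen_base:
  assumes "X dim_le n" and "second_countable X"
  shows "\<exists>\<Z>. countable \<Z> \<and> \<Union>\<Z> = topspace X \<and> (\<forall>Z\<in>\<Z>. \<exists>\<B>. clopen_base (subtopology X Z) \<B>)"
  using assms
proof (induction rule: dimension_le.induct)
  case (1 n X)
  let ?P = "\<lambda>U \<Z>. countable \<Z> \<and> \<Union>\<Z> = X frontier_of U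
    \<and> (\<forall>Z\<in>\<Z>. \<exists>\<B>. clopen_base (subtopology X Z) \<B>)"
  have step: "\<exists>U. x \<in> U \<and> U \<subseteq> V \<and> openin X U \<and> (\<exists>\<Z>. ?P U \<Z>)" if V: "openin X V" "x \<in> V" for V x
  proof -
    obtain U \<Z> where U: "x \<in> U" "U \<subseteq> V" "openin X U" and \<Z>: "countable \<Z>"
      "\<Union>\<Z> = topspace (subtopology X (X frontier_of U))"
      "\<forall>Z\<in>\<Z>. \<exists>\<B>. clopen_base (subtopology (subtopology X (X frontier_of U)) Z) \<B>"
      using 1(2)[OF V] second_countable_subtopology[OF 1(3)] by metis
    have eq: "\<Union>\<Z> = X frontier_of U"
      using \<Z>(2) frontier_of_subset_topspace[of X U] by auto
    have "X frontier_of U \<inter> Z = Z" if "Z \<in> \<Z>" for Z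
      using that eq by blast
    then have "?P U \<Z>"
      using \<Z> eq by (simp add: subtopology_subtopology)
    then show ?thesis
      using U by blast
  qed
  obtain \<C> where \<C>: "countable \<C>" "\<And>U. U \<in> \<C> \<Longrightarrow> openin X U \<and> (\<exists>\<Z>. ?P U \<Z>)"
    and base: "\<And>V x. openin X V \<Longrightarrow> x \<in> V \<Longrightarrow> \<exists>U\<in>\<C>. x \<in> U \<and> U \<subseteq> V"
    by (rule second_countable_subbase[OF 1(3) step]) (assumption, assumption, rule that)
  obtain z where z: "\<And>U. U \<in> \<C> \<Longrightarrow> ?P U (z U)"
    using \<C>(2) by metis
  define Z\<^sub>0 where "Z\<^sub>0 = topspace X - (\<Union>U\<in>\<C>. X frontier_of U)"
  have "openin (subtopology X Z\<^sub>0) (Z\<^sub>0 \<inter> U) \<and> closedin (subtopology X Z\<^sub>0) (Z\<^sub>0 \<inter> U)" if "U \<in> \<C>" for U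
  proof
    show "openin (subtopology X Z\<^sub>0) (Z\<^sub>0 \<inter> U)"
      using \<C>(2)[OF that] openin_subtopology_Int2 by blast
    have "Z\<^sub>0 \<inter> X frontier_of U = {}"
      unfolding Z\<^sub>0_def using that by blast
    \<comment> \<open>Off its frontier, an open set coincides with its closure, so its trace on
      \<open>Z\<^sub>0\<close> is also closed.\<close>
    then have "Z\<^sub>0 \<inter> U = Z\<^sub>0 \<inter> X closure_of U"
      using \<C>(2)[OF that] closure_of_subset[OF openin_subset, of X U] frontier_of_openin[of X U] by blast
    then show "closedin (subtopology X Z\<^sub>0) (Z\<^sub>0 \<inter> U)"
      unfolding closedin_subtopology by (metis closedin_closure_of inf_commute)
  qed
  moreover have "\<exists>W\<in>(\<inter>) Z\<^sub>0 ` \<C>. x \<in> W \<and> W \<subseteq> V" if V: "openin (subtopology X Z\<^sub>0) V" "x \<in> V" for V x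
  proof -
    obtain T where T: "openin X T" "V = T \<inter> Z\<^sub>0"
      using V(1) unfolding openin_subtopology by blast
    then obtain U where "U \<in> \<C>" "x \<in> U" "U \<subseteq> T"
      using base[OF T(1), of x] V(2) by blast
    then show ?thesis
      using T(2) V(2) by (intro bexI[of _ "Z\<^sub>0 \<inter> U"]) auto
  qed
  ultimately have "clopen_base (subtopology X Z\<^sub>0) ((\<inter>) Z\<^sub>0 ` \<C>)"
    unfolding clopen_base_def using \<C>(1) by (intro conjI allI impI) auto
  moreover have "\<Union>(insert Z\<^sub>0 (\<Union>U\<in>\<C>. z U)) = topspace X"
  proof -
    have "(\<Union>U\<in>\<C>. \<Union>(z U)) = (\<Union>U\<in>\<C>. X frontier_of U)"
      using z by (intro SUP_cong) auto
    moreover have "(\<Union>U\<in>\<C>. X frontier_of U) \<subseteq> topspace X"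
      by (intro UN_least frontier_of_subset_topspace)
    ultimately show ?thesis
      unfolding Z\<^sub>0_def by auto
  qed
  ultimately show ?case
    using z \<C>(1) by (intro exI[of _ "insert Z\<^sub>0 (\<Union>U\<in>\<C>. z U)"]) auto
qed

lemma clopen_base_embedding:
  assumes \<B>: "clopen_base Y \<B>" and "Hausdorff_space Y"
  obtains h :: "'a \<Rightarrow> baire" where "inj_on h (topspace Y)"
    "\<And>x m. x \<in> topspace Y \<Longrightarrow> \<exists>V. openin Y V \<and> x \<in> V \<and> (\<forall>y\<in>V. agree m (h x) (h y))"
    "\<And>x V. openin Y V \<Longrightarrow> x \<in> V \<Longrightarrow> \<exists>m. \<forall>y\<in>topspace Y. agree m (h x) (h y) \<longrightarrow> y \<in> V"
proof -
  \<comment> \<open>\<open>h x\<close> will be the characteristic sequence of the base sets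
    containing \<open>x\<close>; the extra \<open>{}\<close> allows an enumeration even if the base
    is empty.\<close>
  define b where "b = from_nat_into (insert {} \<B>)"
  define h :: "'a \<Rightarrow> baire" where "h x n = (if x \<in> b n then 1 else 0)" for x n
  have \<B>_countable: "countable \<B>" and \<B>_clopen: "\<And>U. U \<in> \<B> \<Longrightarrow> openin Y U \<and> closedin Y U"
    and base: "\<And>V x. openin Y V \<Longrightarrow> x \<in> V \<Longrightarrow> \<exists>U\<in>\<B>. x \<in> U \<and> U \<subseteq> V"
    using \<B> by (simp_all add: clopen_base_def)
  have b: "range b = insert {} \<B>"
    unfolding b_def using \<B>_countable by (intro range_from_nat_into) auto
  have clopen: "openin Y (b n)" "closedin Y (b n)" for n
    using \<B>_clopen rangeI[of b n] unfolding b by auto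
  have *: "\<exists>m. \<forall>y\<in>topspace Y. agree m (h x) (h y) \<longrightarrow> y \<in> V" if V: "openin Y V" "x \<in> V" for x V
  proof -
    obtain U where U: "U \<in> \<B>" "x \<in> U" "U \<subseteq> V"
      using base[OF V] by blast
    then obtain n where n: "b n = U"
      using b by (metis insertCI imageE)
    have "y \<in> V" if "agree (Suc n) (h x) (h y)" for y
    proof -
      have "h x n = h y n"
        using that by (simp add: agree_def)
      then show ?thesis
        using U n by (auto simp: h_def split: if_splits)
    qed
    then show ?thesis by blast
  qed
  show ?thesis
  proof
    show "inj_on h (topspace Y)"
    proof (rule inj_onI, rule ccontr)
      fix x y assume xy: "x \<in> topspace Y" "y \<in> topspace Y" "h x = h y" "x \<noteq> y"
      then obtain V where "openin Y V" "x \<in> V" "y \<notin> V"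
        using assms(2) unfolding Hausdorff_space_def disjnt_def by (metis disjoint_iff)
      then show False
        using *[of V x] xy by auto
    qed
    show "\<exists>V. openin Y V \<and> x \<in> V \<and> (\<forall>y\<in>V. agree m (h x) (h y))" if "x \<in> topspace Y" for x m
    proof (induction m)
      case 0
      then show ?case
        using that by (intro exI[of _ "topspace Y"]) (auto simp: agree_def)
    next
      case (Suc m)
      then obtain V where V: "openin Y V" "x \<in> V" "\<forall>y\<in>V. agree m (h x) (h y)" by blast
      \<comment> \<open>Fixing one more bit of \<open>h\<close> is an open condition in either case
        because \<open>b m\<close> is clopen.\<close>
      let ?W = "if x \<in> b m then b m else topspace Y - b m"
      have "\<forall>y\<in>V \<inter> ?W. agree (Suc m) (h x) (h y)"
        using V(3) by (auto simp: agree_def less_Suc_eq h_def)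
      moreover have "openin Y (V \<inter> ?W)" "x \<in> V \<inter> ?W"
        using V clopen[of m] that by auto
      ultimately show ?case by blast
    qed
  qed (use * in blast)
qed


section \<open>Spectra of countable dimensional spaces\<close>

text \<open>
  A convergent sequence is the image of a continuous function on Baire space that reads off
  the first nonzero position; admissibility lifts it to a convergent sequence of names.
\<close>

lemma admissible_lift_sequence:
  assumes adm: "admissible_representation X \<delta>"
    and lim: "limitin X \<sigma> l sequentially" and \<sigma>: "range \<sigma> \<subseteq> topspace X"
  obtains r s where "\<delta> r = Some l" "\<And>n. \<delta> (s n) = Some (\<sigma> n)"
    "\<And>m. \<exists>N. \<forall>n\<ge>N. agree m r (s n)"
proof -
  define \<phi> where "\<phi> z = Some (if \<exists>i. z i \<noteq> 0 then \<sigma> (LEAST i. z i \<noteq> 0) else l)" for z :: baire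
  have l: "l \<in> topspace X"
    using lim by (simp add: limitin_def)
  have "partial_continuous euclidean X \<phi>"
    unfolding partial_continuous_baire_iff
  proof (intro conjI allI ballI impI)
    show "the (\<phi> z) \<in> topspace X" for z
      using l \<sigma> by (auto simp: \<phi>_def)
    fix V z assume V: "openin X V" "the (\<phi> z) \<in> V"
    show "\<exists>m. \<forall>z'\<in>dom \<phi>. agree m z z' \<longrightarrow> the (\<phi> z') \<in> V"
    proof (cases "\<exists>i. z i \<noteq> 0")
      case True
      \<comment> \<open>Near a nonzero \<open>z\<close>, \<open>\<phi>\<close> is constant: a prefix
        of length \<open>Suc k\<close> fixes the first nonzero position.\<close>
      define k where "k = (LEAST i. z i \<noteq> 0)"
      have "\<phi> z' = \<phi> z" if "agree (Suc k) z z'" for z'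
      proof -
        have zk: "z k \<noteq> 0" "\<And>i. i < k \<Longrightarrow> z i = 0"
          unfolding k_def using LeastI_ex[OF True] not_less_Least by auto
        then have z'k: "z' k \<noteq> 0" "\<And>i. i < k \<Longrightarrow> z' i = 0"
          using that unfolding agree_def by auto
        then have "(LEAST i. z' i \<noteq> 0) = k"
          by (intro Least_equality) (auto simp: not_less[symmetric])
        moreover have "\<exists>i. z' i \<noteq> 0"
          using z'k by blast
        ultimately show ?thesis
          using True by (simp only: \<phi>_def k_def if_True)
      qed
      then show ?thesis
        using V by metis
    next
      case False
      then have "l \<in> V"
        using V by (simp add: \<phi>_def)
      then obtain N where N: "\<And>n. n \<ge> N \<Longrightarrow> \<sigma> n \<in> V"
        using lim V(1) unfolding limitin_def eventually_sequentially by blast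
      \<comment> \<open>Here \<open>z\<close> is the zero sequence: a nonzero \<open>z'\<close>
        agreeing with it below \<open>N\<close> has its first nonzero position at \<open>N\<close>
        or later, where \<open>\<sigma>\<close> is already in \<open>V\<close>.\<close>
      have "the (\<phi> z') \<in> V" if "agree N z z'" for z'
      proof (cases "\<exists>i. z' i \<noteq> 0")
        case True
        have "z' (LEAST i. z' i \<noteq> 0) \<noteq> 0"
          by (rule LeastI_ex[OF True])
        then have "\<not> (LEAST i. z' i \<noteq> 0) < N"
          using that False unfolding agree_def by metis
        then show ?thesis
          using N True by (simp add: \<phi>_def)
      qed (use \<open>l \<in> V\<close> in \<open>simp add: \<phi>_def\<close>)
      then show ?thesis by blast
    qed
  qed
  then obtain G where G: "partial_continuous euclidean euclidean G"
    and G\<phi>: "\<forall>z\<in>dom \<phi>. \<phi> z = (\<delta> \<circ>\<^sub>m G) z"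
    using adm unfolding admissible_representation_def by blast
  have \<phi>_dom: "z \<in> dom \<phi>" for z
    by (simp add: \<phi>_def domIff)
  have G_some: "\<exists>g. G z = Some g \<and> \<delta> g = \<phi> z" for z
  proof -
    have "\<phi> z = (\<delta> \<circ>\<^sub>m G) z"
      using G\<phi> \<phi>_dom by blast
    moreover have "\<phi> z \<noteq> None"
      by (simp add: \<phi>_def)
    ultimately show ?thesis
      by (cases "G z") auto
  qed
  then have G_the: "\<delta> (the (G z)) = \<phi> z" for z
    by (metis option.sel)
  \<comment> \<open>The points \<open>e n\<close> code the terms \<open>\<sigma> n\<close> and
    converge to the zero sequence, which codes \<open>l\<close>; their images under \<open>G\<close>
    are the required names.\<close>
  define e :: "nat \<Rightarrow> baire" where "e n i = (if i = n then 1 else 0)" for n i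
  have "(LEAST i. e n i \<noteq> 0) = n" for n
    by (rule Least_equality) (auto simp: e_def split: if_splits)
  then have \<phi>_e: "\<phi> (e n) = Some (\<sigma> n)" for n
    unfolding \<phi>_def by (auto simp: e_def)
  show ?thesis
  proof
    show "\<delta> (the (G (\<lambda>_. 0))) = Some l"
      using G_the by (simp add: \<phi>_def)
    show "\<delta> (the (G (e n))) = Some (\<sigma> n)" for n
      using G_the \<phi>_e by simp
    fix m
    have "(\<lambda>_. 0) \<in> dom G"
      using G_some[of "\<lambda>_. 0"] by auto
    then obtain N where N:
      "\<forall>z\<in>dom G. agree N (\<lambda>_. 0) z \<longrightarrow> agree m (the (G (\<lambda>_. 0))) (the (G z))"
      using partial_continuous_agree[OF G] by blast
    have "e n \<in> dom G" "agree N (\<lambda>_. 0) (e n)" if "n \<ge> N" for n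
      using that G_some[of "e n"] by (auto simp: agree_def e_def)
    then show "\<exists>N. \<forall>n\<ge>N. agree m (the (G (\<lambda>_. 0))) (the (G (e n)))"
      using N by blast
  qed
qed

lemma agree_pair_baire: "agree m q q' \<Longrightarrow> agree m (pair_baire p q) (pair_baire p q')"
  unfolding agree_def pair_baire_def by auto

text \<open>
  \<open>h x\<close> is a point of Turing degree \<open>deg\<^sup>p(x)\<close>, and \<open>d\<close>, \<open>e\<close> are the reductions. They make
  \<open>h\<close> a homeomorphism onto a subspace of Baire space.
\<close>

lemma uniform_reductions_imp_dim_le_0:
  assumes "metrizable_space X" and adm: "admissible_representation X \<delta>" and S: "S \<subseteq> topspace X"
    and d: "\<And>x r n. \<lbrakk>x \<in> S; \<delta> r = Some x\<rbrakk> \<Longrightarrow> runs (pair_baire p r) d [n] (h x n)"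
    and e: "\<And>x. x \<in> S \<Longrightarrow> \<exists>r. \<delta> r = Some x \<and> (\<forall>n. runs (h x) e [n] (pair_baire p r n))"
  shows "subtopology X S dim_le 0"
proof -
  let ?Y = "subtopology X S"
  have topY: "topspace ?Y = S"
    using S by auto
  \<comment> \<open>Both truth values are treated together, so preimages of cylinders and their
    complements are closed, hence clopen. In a metrizable subspace, sequences test
    closedness.\<close>
  have closed: "closedin ?Y {y \<in> S. agree m (h x) (h y) \<longleftrightarrow> b}" (is "closedin _ ?C") for x m b
  proof -
    obtain M D where "Metric_space M D" and Y: "?Y = Metric_space.mtopology M D"
      using metrizable_space_subtopology[OF assms(1), of S] unfolding metrizable_space_def by blast
    then interpret Metric_space M D by simp
    have MS: "M = S"
      using topY unfolding Y by simp
    show ?thesis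
      unfolding Y metric_closedin_iff_sequentially_closed
    proof (intro conjI allI impI)
      show "?C \<subseteq> M"
        using MS by auto
      fix \<sigma> l assume \<sigma>: "range \<sigma> \<subseteq> ?C \<and> limitin mtopology \<sigma> l sequentially"
      then have l: "l \<in> S" and lim: "limitin X \<sigma> l sequentially"
        unfolding Y[symmetric] by (auto simp: limitin_subtopology)
      have \<sigma>S: "\<sigma> n \<in> S" for n
        using \<sigma> by auto
      then obtain r s where rs: "\<delta> r = Some l" "\<And>n. \<delta> (s n) = Some (\<sigma> n)"
        "\<And>m. \<exists>N. \<forall>n\<ge>N. agree m r (s n)"
        using admissible_lift_sequence[OF adm lim] S by blast
      \<comment> \<open>By the use of \<open>d\<close>, names close enough to \<open>r\<close> yield
        the first \<open>m\<close> values of \<open>h l\<close>; a late enough \<open>s n\<close> is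
        such a name.\<close>
      obtain k where k: "\<And>q. agree k (pair_baire p r) q \<Longrightarrow> \<forall>n<m. runs q d [n] (h l n)"
        using runs_use_all[of m "pair_baire p r" d "h l"] d[OF l rs(1)] by blast
      obtain N where N: "agree k r (s N)"
        using rs(3) by blast
      have "agree m (h l) (h (\<sigma> N))"
        using k[OF agree_pair_baire[OF N]] d[OF \<sigma>S rs(2)] runs_deterministic
        unfolding agree_def by blast
      moreover have "agree m (h x) (h (\<sigma> N)) \<longleftrightarrow> b"
        using \<sigma> by auto
      ultimately show "l \<in> ?C"
        using l unfolding agree_def by auto
    qed
  qed
  have "\<exists>U. x \<in> U \<and> U \<subseteq> V \<and> closedin ?Y U \<and> openin ?Y U" if V: "openin ?Y V" "x \<in> V" for V x
  proof -
    obtain T where T: "openin X T" "V = T \<inter> S"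
      using V(1) unfolding openin_subtopology by blast
    have x: "x \<in> S" "x \<in> T"
      using V(2) T(2) by auto
    obtain r where r: "\<delta> r = Some x" "\<And>n. runs (h x) e [n] (pair_baire p r n)"
      using e[OF x(1)] by blast
    have "partial_continuous euclidean X \<delta>" "r \<in> dom \<delta>" "the (\<delta> r) \<in> T"
      using adm r(1) x(2) unfolding admissible_representation_def by auto
    then obtain k where k: "\<And>r'. r' \<in> dom \<delta> \<Longrightarrow> agree k r r' \<Longrightarrow> the (\<delta> r') \<in> T"
      using partial_continuous_baireD[OF _ _ T(1)] by meson
    \<comment> \<open>Entry \<open>i\<close> of a name sits at position \<open>2 * i + 1\<close> of
      the pair, so \<open>2 * k\<close> outputs of \<open>e\<close> cover its first \<open>k\<close>
      entries.\<close>
    obtain m where m: "\<And>q. agree m (h x) q \<Longrightarrow> \<forall>n<2 * k. runs q e [n] (pair_baire p r n)"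
      using runs_use_all[of "2 * k" "h x" e "pair_baire p r"] r(2) by blast
    have "y \<in> V" if y: "y \<in> S" "agree m (h x) (h y)" for y
    proof -
      obtain r' where r': "\<delta> r' = Some y" "\<And>n. runs (h y) e [n] (pair_baire p r' n)"
        using e[OF y(1)] by blast
      have pair: "agree (2 * k) (pair_baire p r) (pair_baire p r')"
        using m[OF y(2)] r'(2) runs_deterministic unfolding agree_def by blast
      have "r i = r' i" if "i < k" for i
      proof -
        have "Suc (2 * i) < 2 * k"
          using that by linarith
        then have "pair_baire p r (Suc (2 * i)) = pair_baire p r' (Suc (2 * i))"
          using pair unfolding agree_def by blast
        then show ?thesis
          by simp
      qed
      then have "agree k r r'"
        by (simp add: agree_def)
      then show ?thesis
        using k[of r'] r'(1) y(1) T(2) by auto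
    qed
    moreover have "{y \<in> S. agree m (h x) (h y)} = topspace ?Y - {y \<in> S. \<not> agree m (h x) (h y)}"
      unfolding topY by auto
    then have "openin ?Y {y \<in> S. agree m (h x) (h y)}"
      using closed[of m x False] openin_diff[OF openin_topspace] by metis
    ultimately show ?thesis
      using closed[of m x True] x(1)
      by (intro exI[of _ "{y \<in> S. agree m (h x) (h y)}"]) auto
  qed
  then show ?thesis
    unfolding dimension_le_0_neighbourhood_base_of_clopen
    by (subst open_neighbourhood_base_of) blast+
qed

lemma Turing_spectrum_imp_countable_dimensional:
  assumes "metrizable_space X" "admissible_representation X \<delta>" "spectrum p X \<delta> \<subseteq> turing_degrees"
  shows "countable_dimensional_space X"
proof -
  let ?fiber = "\<lambda>x. {r. \<delta> r = Some x}"
  let ?R = "\<lambda>d e x q. (\<forall>r. \<delta> r = Some x \<longrightarrow> (\<forall>n. runs (pair_baire p r) d [n] (q n)))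
    \<and> (\<exists>r. \<delta> r = Some x \<and> (\<forall>n. runs q e [n] (pair_baire p r n)))"
  define S where "S c = {x \<in> topspace X. \<exists>q. ?R (fst c) (snd c) x q}" for c
  have "subtopology X (S c) dim_le 0" for c
  proof -
    have "\<exists>q. ?R (fst c) (snd c) x q" if "x \<in> S c" for x
      using that by (simp add: S_def)
    \<comment> \<open>The choice of \<open>h\<close> is arbitrary; the two programs fixed for the
      piece force its continuity properties.\<close>
    then obtain h where h: "\<And>x. x \<in> S c \<Longrightarrow> ?R (fst c) (snd c) x (h x)"
      by metis
    show ?thesis
      by (rule uniform_reductions_imp_dim_le_0[OF assms(1,2), of _ p "fst c" h "snd c"])
        (use h in \<open>auto simp: S_def\<close>)
  qed
  moreover have "x \<in> (\<Union>c. S c)" if x: "x \<in> topspace X" for x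
  proof -
    have "point_degree p \<delta> x \<in> turing_degrees"
      using assms(3) x unfolding spectrum_def by blast
    then obtain q where "pair_baire p ` ?fiber x \<le>\<^sub>M {q}" "{q} \<le>\<^sub>M pair_baire p ` ?fiber x"
      unfolding turing_degrees_def point_degree_def by (auto simp: medvedev_degree_eq_iff)
    \<comment> \<open>\<open>d\<close> must give \<open>q\<close> from every name of
      \<open>x\<close>, while \<open>e\<close> only has to produce some name from
      \<open>q\<close>.\<close>
    then obtain d e where "\<forall>r\<in>pair_baire p ` ?fiber x. \<forall>n. runs r d [n] (q n)"
      "\<exists>s\<in>pair_baire p ` ?fiber x. \<forall>n. runs q e [n] (s n)"
      unfolding medvedev_le_iff by auto
    then have "?R d e x q"
      by auto
    then have "x \<in> S (d, e)"
      using x unfolding S_def by auto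
    then show ?thesis
      by blast
  qed
  then have "(\<Union>c. S c) = topspace X"
    by (auto simp: S_def)
  ultimately show ?thesis
    unfolding countable_dimensional_space_def finite_dimensional_space_def
    by (intro exI[of _ "range S"]) auto
qed

section \<open>From countable dimension to Turing degrees\<close>

lemma countable_dimensional_imp_countable_union_clopen_base:
  assumes "second_countable X" "countable_dimensional_space X"
  obtains Z :: "nat \<Rightarrow> 'a set" where "(\<Union>k. Z k) = topspace X"
    "\<And>k. \<exists>\<B>. clopen_base (subtopology X (Z k)) \<B>"
proof -
  let ?P = "\<lambda>S \<Z>. countable \<Z> \<and> \<Union>\<Z> = S \<and> (\<forall>Z\<in>\<Z>. \<exists>\<B>. clopen_base (subtopology X Z) \<B>)"
  obtain \<S> where \<S>: "countable \<S>" "\<Union>\<S> = topspace X"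
    "\<And>S. S \<in> \<S> \<Longrightarrow> \<exists>n. subtopology X S dim_le n"
    using assms(2) unfolding countable_dimensional_space_def finite_dimensional_space_def by metis
  have "\<exists>\<Z>. ?P S \<Z>" if S: "S \<in> \<S>" for S
  proof -
    obtain n where n: "subtopology X S dim_le n"
      using \<S>(3)[OF S] by blast
    obtain \<Z> where \<Z>: "countable \<Z>" "\<Union>\<Z> = topspace (subtopology X S)"
      "\<And>Z. Z \<in> \<Z> \<Longrightarrow> \<exists>\<B>. clopen_base (subtopology (subtopology X S) Z) \<B>"
      using dim_le_imp_countable_union_clopen_base[OF n second_countable_subtopology[OF assms(1)]]
      by metis
    have "topspace (subtopology X S) = S"
      using \<S>(2) S by auto
    then have eq: "\<Union>\<Z> = S"
      using \<Z>(2) by simp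
    then have "S \<inter> Z = Z" if "Z \<in> \<Z>" for Z
      using that by blast
    then have "?P S \<Z>"
      using \<Z>(1,3) eq by (simp add: subtopology_subtopology)
    then show ?thesis by blast
  qed
  then obtain z where z: "\<And>S. S \<in> \<S> \<Longrightarrow> ?P S (z S)"
    by metis
  \<comment> \<open>The empty piece, whose clopen base is empty, makes the family nonempty and thus
    enumerable by the naturals.\<close>
  let ?\<Z> = "insert {} (\<Union>S\<in>\<S>. z S)"
  have "countable ?\<Z>"
    using z \<S>(1) by auto
  then have range: "range (from_nat_into ?\<Z>) = ?\<Z>"
    by (intro range_from_nat_into) auto
  have "clopen_base (subtopology X {}) {}"
    by (simp add: clopen_base_def)
  then have "\<exists>\<B>. clopen_base (subtopology X Z) \<B>" if "Z \<in> ?\<Z>" for Z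
    using that z by blast
  moreover have "\<Union>?\<Z> = topspace X"
  proof -
    have "\<Union>?\<Z> = (\<Union>S\<in>\<S>. \<Union>(z S))"
      by blast
    also have "\<dots> = (\<Union>S\<in>\<S>. S)"
      using z by (intro SUP_cong) auto
    finally show ?thesis
      using \<S>(2) by simp
  qed
  ultimately show ?thesis
    using that[of "from_nat_into ?\<Z>"] range by (metis rangeI)
qed

lemma countable_dimensional_imp_Turing_spectrum:
  assumes "metrizable_space X" "separable_space X" and adm: "admissible_representation X \<delta>"
    and "countable_dimensional_space X"
  shows "\<exists>p. range p \<subseteq> {0, 1} \<and> spectrum p X \<delta> \<subseteq> turing_degrees"
proof -
  obtain Z :: "nat \<Rightarrow> 'a set" where Z: "(\<Union>k. Z k) = topspace X"
    "\<And>k. \<exists>\<B>. clopen_base (subtopology X (Z k)) \<B>"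
    using countable_dimensional_imp_countable_union_clopen_base assms
      metrizable_separable_imp_second_countable by metis
  have topZ: "topspace (subtopology X (Z k)) = Z k" for k
    using Z(1) by auto
  define good where "good k G H q \<longleftrightarrow> partial_continuous euclidean euclidean G
      \<and> partial_continuous euclidean euclidean H
      \<and> (\<forall>x\<in>Z k. \<exists>r. G (q x) = Some r \<and> \<delta> r = Some x)
      \<and> (\<forall>x\<in>Z k. \<forall>r. \<delta> r = Some x \<longrightarrow> H r = Some (q x))"
    for k and G H :: "baire \<rightharpoonup> baire" and q :: "'a \<Rightarrow> baire"
  have "\<exists>G H q. good k G H q" for k
  proof -
    let ?Y = "subtopology X (Z k)"
    have "Hausdorff_space ?Y"
      using assms(1) Hausdorff_space_subtopology metrizable_imp_Hausdorff_space by blast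
    then obtain h :: "'a \<Rightarrow> baire" where inj: "inj_on h (Z k)"
      and cont: "\<And>x m. x \<in> Z k \<Longrightarrow> \<exists>V. openin ?Y V \<and> x \<in> V \<and> (\<forall>y\<in>V. agree m (h x) (h y))"
      and inv_cont: "\<And>x V. openin ?Y V \<Longrightarrow> x \<in> V \<Longrightarrow> \<exists>m. \<forall>y\<in>Z k. agree m (h x) (h y) \<longrightarrow> y \<in> V"
      using Z(2)[of k] clopen_base_embedding[of ?Y] unfolding topZ by metis
    \<comment> \<open>The inverse of the embedding \<open>h\<close>; its continuity lets
      admissibility lift it to names.\<close>
    define \<phi> where "\<phi> = (\<lambda>s. if s \<in> h ` Z k then Some (inv_into (Z k) h s) else None)"
    have \<phi>_h: "\<phi> (h x) = Some x" if "x \<in> Z k" for x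
      using that inj by (simp add: \<phi>_def)
    have dom_\<phi>: "dom \<phi> = h ` Z k"
      by (auto simp: \<phi>_def dom_def)
    have "partial_continuous euclidean X \<phi>"
      unfolding partial_continuous_baire_iff dom_\<phi>
    proof (intro conjI allI ballI impI)
      show "the (\<phi> s) \<in> topspace X" if "s \<in> h ` Z k" for s
        using that \<phi>_h Z(1) by auto
      fix V s assume V: "openin X V" and s: "s \<in> h ` Z k" "the (\<phi> s) \<in> V"
      obtain x where x: "x \<in> Z k" "s = h x"
        using s by blast
      have V': "openin ?Y (Z k \<inter> V)" "x \<in> Z k \<inter> V"
        using V s x \<phi>_h openin_subtopology_Int2 by auto
      obtain m where "\<forall>y\<in>Z k. agree m (h x) (h y) \<longrightarrow> y \<in> V"
        using inv_cont[OF V'] by blast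
      then show "\<exists>m. \<forall>s'\<in>h ` Z k. agree m s s' \<longrightarrow> the (\<phi> s') \<in> V"
        using x(2) \<phi>_h by auto
    qed
    then obtain G where G: "partial_continuous euclidean euclidean G"
      and G\<phi>: "\<forall>s\<in>dom \<phi>. \<phi> s = (\<delta> \<circ>\<^sub>m G) s"
      using adm unfolding admissible_representation_def by blast
    have G_h: "\<exists>r. G (h x) = Some r \<and> \<delta> r = Some x" if "x \<in> Z k" for x
    proof -
      have "(\<delta> \<circ>\<^sub>m G) (h x) = Some x"
        using G\<phi> \<phi>_h[OF that] dom_\<phi> that by (metis imageI)
      then show ?thesis
        by (auto simp: map_comp_def split: option.splits)
    qed
    \<comment> \<open>The composition of \<open>h\<close> with \<open>\<delta>\<close>, restricted
      to names of points of \<open>Z k\<close>.\<close>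
    define H where "H r =
      (case \<delta> r of Some x \<Rightarrow> if x \<in> Z k then Some (h x) else None | None \<Rightarrow> None)" for r
    have H: "r \<in> dom H \<longleftrightarrow> (\<exists>x\<in>Z k. \<delta> r = Some x)" for r
      by (auto simp: H_def dom_def split: option.splits)
    have H_eq: "H r = Some (h x)" if "x \<in> Z k" "\<delta> r = Some x" for x r
      using that by (simp add: H_def)
    have "partial_continuous euclidean euclidean H"
    proof (rule partial_continuous_baireI)
      fix r m assume "r \<in> dom H"
      then obtain x where x: "x \<in> Z k" "\<delta> r = Some x"
        using H by blast
      obtain V where "openin ?Y V" and V': "x \<in> V" "\<forall>y\<in>V. agree m (h x) (h y)"
        using cont[OF x(1)] by metis
      then obtain T where V: "openin X T" "V = T \<inter> Z k"
        unfolding openin_subtopology by metis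
      have "partial_continuous euclidean X \<delta>" "r \<in> dom \<delta>" "the (\<delta> r) \<in> T"
        using adm x(2) V V' unfolding admissible_representation_def by auto
      then obtain j where j: "\<forall>r'\<in>dom \<delta>. agree j r r' \<longrightarrow> the (\<delta> r') \<in> T"
        using partial_continuous_baireD[OF _ _ V(1)] by meson
      have "agree m (the (H r)) (the (H r'))" if r': "r' \<in> dom H" "agree j r r'" for r'
      proof -
        obtain y where y: "y \<in> Z k" "\<delta> r' = Some y"
          using r'(1) H by blast
        have "r' \<in> dom \<delta>"
          using y by auto
        then have "y \<in> V"
          using j r'(2) y V(2) by fastforce
        then show ?thesis
          using H_eq[OF x] H_eq[OF y] V'(2) by simp
      qed
      then show "\<exists>j. \<forall>r'\<in>dom H. agree j r r' \<longrightarrow> agree m (the (H r)) (the (H r'))"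
        by blast
    qed
    then have "good k G H h"
      unfolding good_def using G G_h H_eq by blast
    then show ?thesis by blast
  qed
  then obtain G H q where "\<And>k. good k (G k) (H k) (q k)"
    by metis
  then have GH: "\<And>k. partial_continuous euclidean euclidean (G k)"
      "\<And>k. partial_continuous euclidean euclidean (H k)"
    and G: "\<And>k x. x \<in> Z k \<Longrightarrow> \<exists>r. G k (q k x) = Some r \<and> \<delta> r = Some x"
    and H: "\<And>k x r. x \<in> Z k \<Longrightarrow> \<delta> r = Some x \<Longrightarrow> H k r = Some (q k x)"
    by (simp_all add: good_def)
  \<comment> \<open>Interleaving makes one table serve all functions: \<open>G k\<close> has index
    \<open>2 * k\<close> and \<open>H k\<close> has index \<open>2 * k + 1\<close>.\<close>
  define F where "F k = (if even k then G (k div 2) else H (k div 2))" for k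
  let ?p = "table F"
  have F: "partial_continuous euclidean euclidean (F k)" for k
    using GH by (simp add: F_def)
  have runs: "runs (pair_baire ?p r) (pair_prog k) [n] (pair_baire ?p s n)" if "F k r = Some s" for k r s n
  proof -
    have "r \<in> dom (F k)"
      using that by blast
    then show ?thesis
      using runs_pair[of r F k n, OF _ partial_continuous_determines[OF F]] that by simp
  qed
  have "point_degree ?p \<delta> x \<in> turing_degrees" if x: "x \<in> topspace X" for x
  proof -
    \<comment> \<open>Degrees are compared one point at a time, so the programs may depend on
      \<open>x\<close> through \<open>k\<close>.\<close>
    obtain k where k: "x \<in> Z k"
      using x Z(1) by blast
    let ?A = "pair_baire ?p ` {r. \<delta> r = Some x}" and ?q = "pair_baire ?p (q k x)"
    obtain r where r: "F (2 * k) (q k x) = Some r" "\<delta> r = Some x"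
      using G[OF k] by (auto simp: F_def)
    have "?A \<le>\<^sub>M {?q}"
      unfolding medvedev_le_iff using runs[OF r(1)] r(2) by blast
    moreover have "F (Suc (2 * k)) s = Some (q k x)" if "\<delta> s = Some x" for s
      using H[OF k that] by (simp add: F_def)
    then have "{?q} \<le>\<^sub>M ?A"
      unfolding medvedev_le_iff using runs by blast
    ultimately show ?thesis
      unfolding turing_degrees_def point_degree_def by (auto simp: medvedev_degree_eq_iff)
  qed
  then have "spectrum ?p X \<delta> \<subseteq> turing_degrees"
    unfolding spectrum_def by (rule image_subsetI)
  then show ?thesis
    using range_table[of F] by (intro exI[of _ ?p] conjI)
qed

theorem corollary3p7:
  fixes X :: "'a topology" and \<delta> :: "baire \<rightharpoonup> 'a"
  assumes "metrizable_space X" and "separable_space X"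
    and "admissible_representation X \<delta>"
  shows "(\<exists>p :: baire. range p \<subseteq> {0, 1} \<and> spectrum p X \<delta> \<subseteq> turing_degrees)
    \<longleftrightarrow> countable_dimensional_space X"
  using Turing_spectrum_imp_countable_dimensional[OF assms(1,3)]
    countable_dimensional_imp_Turing_spectrum[OF assms] by blast

end
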